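(* Let $\sum_{i\in S}P(w(i)=1)<1$ and $d\geq 0$. Then the height $H:=\sup_{i\in\Sigma}\sum_{n=0}^\infty l(i|n)X_{i|n}$ of the perturbed multiplicative cascade satisfies $E(H^d)<\infty$.
   Context: $S$ is a finite index set with $N:=|S|$ elements. $\Sigma_n:=S^n$ (with $\Sigma_0:=\{\emptyset\}$), $\Sigma_*:=\bigcup_{n\geq0}\Sigma_n$, $\Sigma:=S^{\mathbb{N}}$; $|i|$ is the length of $i\in\Sigma_*$ and $i|m$ is the truncation of $i$ to its first $m$ letters. A multiplicative cascade is a family of random variables $(w(i))_{i\in\Sigma_*\setminus\{\emptyset\}}$ with values in $[0,1]$ such that the $N$-tuples $(w(ij))_{j\in S}$, $i\in\Sigma_*$, are independent copies of $(w(j))_{j\in S}$ (no independence is assumed within a tuple). $\mathcal{F}_n:=\sigma(w(i):|i|\leq n)$. $l(\emptyset):=1$ and $l(i):=w(i|1)w(i|2)\cdots w(i)$ for $i\in\Sigma_*\setminus\{\emptyset\}$. The perturbations $(X_i)_{i\in\Sigma_*}$ are identically distributed non-negative random variables on the same probability space such that $E(X_i^\theta)<\infty$ for every $\theta>0$ and $X_i$ is independent of $\mathcal{F}_{|i|}$ for every $i\in\Sigma_*$. *)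

theory Defs
  imports "HOL-Probability.Probability"
begin

text \<open>
  Finite words over the alphabet \<^term>\<open>S\<close> are the elements of \<^term>\<open>lists S\<close>, with
  \<^term>\<open>i @ [j]\<close> for the word \<open>ij\<close>; the truncation of a word to its first \<open>m\<close> letters is
  \<^term>\<open>take m i\<close>.  Infinite words are functions \<^typ>\<open>nat \<Rightarrow> 'a\<close> with values in \<^term>\<open>S\<close>, and
  \<open>trunc i n\<close> is the truncation of an infinite word to its first \<open>n\<close> letters.  The value of
  the family \<open>w\<close> at the empty word is never used.
\<close>

definition trunc :: "(nat \<Rightarrow> 'a) \<Rightarrow> nat \<Rightarrow> 'a list" where
  "trunc i n = map i [0..<n]"

definition past_events :: "'m measure \<Rightarrow> 'a set \<Rightarrow> ('a list \<Rightarrow> 'm \<Rightarrow> real) \<Rightarrow> nat \<Rightarrow> 'm set set" where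
  "past_events M S w n = sigma_sets (space M)
     (\<Union>i\<in>{i\<in>lists S. i \<noteq> [] \<and> length i \<le> n}. {w i -` A \<inter> space M | A. A \<in> sets borel})"

locale multiplicative_cascade = prob_space M
  for M :: "'m measure" and S :: "'a set" and w :: "'a list \<Rightarrow> 'm \<Rightarrow> real" +
  assumes finite_S: "finite S"
    and w_measurable: "\<And>i. i \<in> lists S \<Longrightarrow> i \<noteq> [] \<Longrightarrow> w i \<in> borel_measurable M"
    and w_range: "\<And>i x. i \<in> lists S \<Longrightarrow> i \<noteq> [] \<Longrightarrow> x \<in> space M \<Longrightarrow> w i x \<in> {0..1}"
    and w_indep: "indep_vars (\<lambda>_. \<Pi>\<^sub>M j\<in>S. borel) (\<lambda>i x. \<lambda>j\<in>S. w (i @ [j]) x) (lists S)"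
    and w_copies: "\<And>i. i \<in> lists S \<Longrightarrow>
      distr M (\<Pi>\<^sub>M j\<in>S. borel) (\<lambda>x. \<lambda>j\<in>S. w (i @ [j]) x) =
      distr M (\<Pi>\<^sub>M j\<in>S. borel) (\<lambda>x. \<lambda>j\<in>S. w [j] x)"

locale perturbed_multiplicative_cascade = multiplicative_cascade M S w
  for M :: "'m measure" and S :: "'a set" and w :: "'a list \<Rightarrow> 'm \<Rightarrow> real" +
  fixes X :: "'a list \<Rightarrow> 'm \<Rightarrow> real"
  assumes X_measurable: "\<And>i. i \<in> lists S \<Longrightarrow> X i \<in> borel_measurable M"
    and X_nonneg: "\<And>i x. i \<in> lists S \<Longrightarrow> x \<in> space M \<Longrightarrow> 0 \<le> X i x"
    and X_identically_distributed: "\<And>i j. i \<in> lists S \<Longrightarrow> j \<in> lists S \<Longrightarrow>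
      distr M borel (X i) = distr M borel (X j)"
    and X_moments: "\<And>i \<theta>::real. i \<in> lists S \<Longrightarrow> 0 < \<theta> \<Longrightarrow> integrable M (\<lambda>x. X i x powr \<theta>)"
    and X_indep: "\<And>i. i \<in> lists S \<Longrightarrow>
      indep_set {X i -` A \<inter> space M | A. A \<in> sets borel} (past_events M S w (length i))"

definition cascade_weight :: "('a list \<Rightarrow> 'm \<Rightarrow> real) \<Rightarrow> 'a list \<Rightarrow> 'm \<Rightarrow> real" where
  "cascade_weight w i x = (\<Prod>k=1..length i. w (take k i) x)"

text \<open>
  The height takes values in \<open>[0, \<infinity>]\<close>.  The supremum ranges over an in general uncountable set
  of words; lemma \<open>cascade_height_measurable\<close> below shows that it is still a random variable,
  so that its moments are given by \<^const>\<open>nn_integral\<close>.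
\<close>

definition cascade_height ::
    "'a set \<Rightarrow> ('a list \<Rightarrow> 'm \<Rightarrow> real) \<Rightarrow> ('a list \<Rightarrow> 'm \<Rightarrow> real) \<Rightarrow> 'm \<Rightarrow> ennreal" where
  "cascade_height S w X x =
     (SUP i\<in>(UNIV \<rightarrow> S). \<Sum>n. ennreal (cascade_weight w (trunc i n) x * X (trunc i n) x))"

text \<open>
  Real powers on \<open>[0, \<infinity>]\<close> for exponents \<open>d \<ge> 0\<close>.  The exponent 0 is treated separately because
  \<^term>\<open>(0::real) powr 0 = 0\<close>, whereas the zeroth power is constantly 1.
\<close>

definition ennreal_powr :: "ennreal \<Rightarrow> real \<Rightarrow> ennreal" where
  "ennreal_powr h d =
     (if d = 0 then 1 else if h = \<infinity> then \<infinity> else ennreal (enn2real h powr d))"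

lemma trunc_in_lists: "i \<in> UNIV \<rightarrow> S \<Longrightarrow> trunc i n \<in> lists S"
  by (auto simp: trunc_def Pi_iff)

context perturbed_multiplicative_cascade
begin

lemma cascade_weight_measurable:
  assumes "i \<in> lists S"
  shows "cascade_weight w i \<in> borel_measurable M"
  unfolding cascade_weight_def
proof (rule borel_measurable_prod)
  fix k assume k: "k \<in> {1..length i}"
  have "set (take k i) \<subseteq> set i" by (rule set_take_subset)
  then show "w (take k i) \<in> borel_measurable M"
    using k assms by (intro w_measurable) auto
qed

lemma cascade_height_measurable: "cascade_height S w X \<in> borel_measurable M"
proof -
  define g where "g = (\<lambda>v x. \<Sum>n<length v. 
    ennreal (cascade_weight w (take n v) x * X (take n v) x))"
  have tk: "take n (trunc i m) = trunc i n" if "n \<le> m" for n m and i :: "nat \<Rightarrow> 'a"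
    using that by (simp add: trunc_def take_map)
  have len: "length (trunc i m) = m" for m and i :: "nat \<Rightarrow> 'a"
    by (simp add: trunc_def)
  have gt: "g (trunc i m) x = 
    (\<Sum>n<m. ennreal (cascade_weight w (trunc i n) x * X (trunc i n) x))" for i m x
    unfolding g_def len by (intro sum.cong) (auto simp: tk)
  define V where "V = (\<lambda>(i, m). trunc i m) ` ((UNIV \<rightarrow> S) \<times> UNIV)"
  have V: "V \<subseteq> lists S"
    unfolding V_def using trunc_in_lists by fastforce
  have "countable (lists S)"
    using finite_S by (simp add: countable_finite)
  then have cV: "countable V" using V countable_subset by blast
  have eq: "cascade_height S w X x = (SUP v\<in>V. g v x)" for x
  proof -
    have "cascade_height S w X x = (SUP i\<in>(UNIV \<rightarrow> S). SUP m. g (trunc i m) x)"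
      unfolding cascade_height_def gt by (simp add: suminf_eq_SUP)
    also have "\<dots> = (SUP v\<in>V. g v x)"
    proof (intro antisym SUP_least)
      fix i :: "nat \<Rightarrow> 'a" and m assume "i \<in> UNIV \<rightarrow> S"
      then have "trunc i m \<in> V" unfolding V_def by force
      then show "g (trunc i m) x \<le> (SUP v\<in>V. g v x)" by (rule SUP_upper)
    next
      fix v assume "v \<in> V"
      then obtain i m where i: "i \<in> UNIV \<rightarrow> S" and v: "v = trunc i m" unfolding V_def by auto
      show "g v x \<le> (SUP i\<in>(UNIV \<rightarrow> S). SUP m. g (trunc i m) x)"
        unfolding v by (rule SUP_upper2[OF i]) (rule SUP_upper, simp)
    qed
    finally show ?thesis .
  qed
  have "g v \<in> borel_measurable M" if "v \<in> V" for v
  proof -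
    have *: "take n v \<in> lists S" for n
      using that V by (auto dest: in_set_takeD)
    show ?thesis
      unfolding g_def
      using cascade_weight_measurable[OF *] X_measurable[OF *] by measurable
  qed
  then have "(\<lambda>x. SUP v\<in>V. g v x) \<in> borel_measurable M"
    using cV by (intro borel_measurable_SUP)
  then show ?thesis using eq by (simp cong: measurable_cong)
qed

end

end

theory Submission
  imports Defs
begin

text \<open>
  As \<open>m \<rightarrow> \<infinity>\<close>, \<open>q = (\<Sum>j\<in>S. E (w j ^ m))\<close> tends to \<open>(\<Sum>j\<in>S. P (w j = 1)) < 1\<close>, so some \<open>m \<ge> d\<close> has
  \<open>q < 1\<close>.  By independence, \<open>E (\<Sum>\<bar>i\<bar> = n. (l i * X i) ^ m) = q ^ n * E (X ^ m)\<close>.  Choose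
  \<open>r < 1\<close> with \<open>q < r ^ m\<close>.  Along any infinite word the series \<open>\<Sum>n. l (i|n) * X (i|n)\<close> is at most
  \<open>1 / (1 - r)\<close> times the supremum of \<open>l (i|n) * X (i|n) / r ^ n\<close>, and the \<open>m\<close>-th power of that
  supremum is at most the sum of \<open>(l v * X v / r ^ \<bar>v\<bar>) ^ m\<close> over all finite words \<open>v\<close>, whose
  expectation is a convergent geometric series.
\<close>

section \<open>Words, geometric series, powers and independent pairs\<close>

text \<open>The distributive law: expanding the power gives one product for each word of length
  \<open>n\<close>. With moments of the \<open>w [j]\<close> as \<open>p\<close>, this evaluates the
  sum over one level of the tree.\<close>

lemma sum_prod_words:
  fixes p :: "'a \<Rightarrow> 'b::comm_semiring_1"
  shows "(\<Sum>v\<in>{v. set v \<subseteq> S \<and> length v = n}. \<Prod>k<n. p (v ! k)) = (\<Sum>j\<in>S. p j) ^ n"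
proof (induction n)
  case 0
  have "{v. set v \<subseteq> S \<and> v = []} = {[]}" by auto
  then show ?case by simp
next
  case (Suc n)
  have inj: "inj_on (\<lambda>(v, j). j # v) ({v. set v \<subseteq> S \<and> length v = n} \<times> S)"
    by (auto simp: inj_on_def)
  have "(\<Sum>v\<in>{v. set v \<subseteq> S \<and> length v = Suc n}. \<Prod>k<Suc n. p (v ! k)) =
     (\<Sum>(v, j)\<in>{v. set v \<subseteq> S \<and> length v = n} \<times> S. p j * (\<Prod>k<n. p (v ! k)))"
    unfolding lists_length_Suc_eq sum.reindex[OF inj]
    by (simp add: prod.lessThan_Suc_shift case_prod_beta' del: prod.lessThan_Suc)
  also have "\<dots> = (\<Sum>j\<in>S. p j) * (\<Sum>v\<in>{v. set v \<subseteq> S \<and> length v = n}. \<Prod>k<n. p (v ! k))"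
    by (simp add: sum.cartesian_product[symmetric] sum_product sum.swap[of _ S])
  finally show ?case using Suc by simp
qed

lemma suminf_le_geometric:
  fixes a :: "nat \<Rightarrow> real"
  assumes r: "0 < r" "r < 1" and a: "\<And>n. a n \<le> c * r ^ n"
  shows "(\<Sum>n. ennreal (a n)) \<le> ennreal (c / (1 - r))"
proof (cases "0 \<le> c")
  case True
  have "(\<lambda>n. c * r ^ n) sums (c * (1 / (1 - r)))"
    using r by (intro sums_mult geometric_sums) auto
  then have "(\<Sum>n. ennreal (c * r ^ n)) = ennreal (c * (1 / (1 - r)))"
    using True r by (intro suminf_ennreal_eq) auto
  moreover have "(\<Sum>n. ennreal (a n)) \<le> (\<Sum>n. ennreal (c * r ^ n))"
    using a by (intro suminf_le ennreal_leI) auto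
  ultimately show ?thesis by simp
next
  case False
  \<comment> \<open>For negative \<open>c\<close> every \<open>a n\<close> is nonpositive, and
    \<open>ennreal\<close> maps nonpositive reals to 0.\<close>
  then have "a n \<le> 0" for n
    using r a[of n] by (meson mult_nonpos_nonneg order_trans linear zero_le_power less_imp_le)
  then show ?thesis by (simp add: ennreal_neg)
qed

text \<open>The summand 1 covers the exponent 0 and bases at most 1; above 1 the power grows with
  the exponent. For an infinite base the right-hand side is infinite because
  \<open>0 < m\<close>.\<close>

lemma ennreal_powr_le_power:
  assumes "0 \<le> d" "d \<le> real m" "0 < m"
  shows "ennreal_powr h d \<le> 1 + h ^ m"
proof (cases h)
  case (real a)
  have "a powr d \<le> 1 + a ^ m" if "d \<noteq> 0" "0 < d"
  proof (cases "a \<le> 1")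
    case True
    then have "a powr d \<le> 1" using real that by (intro powr_le1) auto
    then show ?thesis using real by (simp add: add_increasing2)
  next
    case False
    then have "a powr d \<le> a powr real m" using assms by (intro powr_mono) auto
    then show ?thesis using False by (simp add: powr_realpow)
  qed
  then show ?thesis
    using real \<open>0 \<le> d\<close>
    by (auto simp: ennreal_powr_def ennreal_power simp flip: ennreal_1 ennreal_plus intro: ennreal_leI)
qed (use assms in \<open>auto simp: ennreal_powr_def top_power_ennreal\<close>)

lemma Int_stable_preimages: "Int_stable {f -` A \<inter> space M | A. A \<in> sets N}"
proof (rule Int_stableI)
  fix a b assume "a \<in> {f -` A \<inter> space M | A. A \<in> sets N}" "b \<in> {f -` A \<inter> space M | A. A \<in> sets N}"
  then obtain A B where "A \<in> sets N" "a = f -` A \<inter> space M" "B \<in> sets N" "b = f -` B \<inter> space M"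
    by auto
  then have "A \<inter> B \<in> sets N" "a \<inter> b = f -` (A \<inter> B) \<inter> space M" by auto
  then show "a \<inter> b \<in> {f -` A \<inter> space M | A. A \<in> sets N}" by blast
qed

lemma (in prob_space) indep_var_nn_integral:
  fixes f g :: "'a \<Rightarrow> ennreal"
  assumes "indep_var borel f borel g"
  shows "(\<integral>\<^sup>+x. f x * g x \<partial>M) = (\<integral>\<^sup>+x. f x \<partial>M) * (\<integral>\<^sup>+x. g x \<partial>M)"
proof -
  \<comment> \<open>A pair is a family over \<open>bool\<close>, so the product formula for finite
    families applies once the target spaces are written as a constant family.\<close>
  have "indep_vars (\<lambda>_. borel) (case_bool f g) UNIV"
    using assms unfolding indep_var_def
    by (subst indep_vars_cong) (auto split: bool.split)
  from indep_vars_nn_integral[OF _ this] show ?thesis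
    by (simp add: UNIV_bool mult.commute)
qed

section \<open>Moments and measurability of the cascade weights\<close>

context multiplicative_cascade
begin

lemma w_single:
  assumes "j \<in> S"
  shows "w [j] \<in> borel_measurable M" "x \<in> space M \<Longrightarrow> 0 \<le> w [j] x" "x \<in> space M \<Longrightarrow> w [j] x \<le> 1"
  using assms w_measurable[of "[j]"] w_range[of "[j]" x] by auto

lemma cascade_weight_nonneg:
  assumes "i \<in> lists S" "x \<in> space M"
  shows "0 \<le> cascade_weight w i x"
  unfolding cascade_weight_def
proof (rule prod_nonneg)
  fix k assume "k \<in> {1..length i}"
  then have "take k i \<in> lists S" "take k i \<noteq> []" using assms by (auto dest: in_set_takeD)
  then show "0 \<le> w (take k i) x" using w_range[of "take k i" x] assms by simp
qed

text \<open>\<open>w_copies\<close> compares laws of whole tuples, so the moment is written as the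
  integral of a coordinate function against such a law, which is the same at \<open>u\<close> and at
  \<open>[]\<close>.\<close>

lemma nn_integral_w_power:
  assumes "u \<in> lists S" "j \<in> S"
  shows "(\<integral>\<^sup>+x. ennreal (w (u @ [j]) x ^ m) \<partial>M) = ennreal (expectation (\<lambda>x. w [j] x ^ m))"
proof -
  have t: "(\<lambda>x. \<lambda>k\<in>S. w (u @ [k]) x) \<in> measurable M (\<Pi>\<^sub>M j\<in>S. borel)" if "u \<in> lists S" for u
    using that w_measurable by (intro measurable_restrict) auto
  have f: "(\<lambda>y. ennreal (y j ^ m)) \<in> borel_measurable (\<Pi>\<^sub>M j\<in>S. borel)"
    using assms by measurable
  have eq: "(\<integral>\<^sup>+x. ennreal (w (u @ [j]) x ^ m) \<partial>M) =
      (\<integral>\<^sup>+y. ennreal (y j ^ m) \<partial>distr M (\<Pi>\<^sub>M j\<in>S. borel) (\<lambda>x. \<lambda>k\<in>S. w (u @ [k]) x))"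
    if "u \<in> lists S" for u
    using assms f by (subst nn_integral_distr[OF t[OF that]]) auto
  have "(\<integral>\<^sup>+x. ennreal (w (u @ [j]) x ^ m) \<partial>M) = (\<integral>\<^sup>+x. ennreal (w [j] x ^ m) \<partial>M)"
    using eq[OF assms(1)] eq[of "[]"] w_copies[OF assms(1)] by simp
  also have "\<dots> = ennreal (expectation (\<lambda>x. w [j] x ^ m))"
  proof (rule nn_integral_eq_integral)
    show "integrable M (\<lambda>x. w [j] x ^ m)"
      using w_single[OF assms(2)]
      by (intro integrable_const_bound[where B = 1]) (auto simp: power_le_one)
  qed (use w_single[OF assms(2)] in auto)
  finally show ?thesis .
qed

text \<open>An index shift by one exhibits each factor as coordinate \<open>v ! k\<close> of the
  tuple attached to the prefix \<open>take k v\<close>, the form in which independence of the tuples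
  can be used.\<close>

lemma cascade_weight_eq_prod:
  "cascade_weight w v x = (\<Prod>k<length v. w (take k v @ [v ! k]) x)"
  unfolding cascade_weight_def
proof (rule prod.reindex_bij_witness[where i = Suc and j = "\<lambda>k. k - 1"])
  fix k assume "k \<in> {1..length v}"
  then show "w (take (k - 1) v @ [v ! (k - 1)]) x = w (take k v) x"
    by (cases k) (auto simp: take_Suc_conv_app_nth)
qed auto

text \<open>The factors of a weight belong to tuples at distinct prefixes of \<open>v\<close>. Hence
  independence between tuples makes the moment factorize, whatever the dependence within a
  tuple.\<close>

lemma nn_integral_cascade_weight_power:
  assumes v: "v \<in> lists S"
  shows "(\<integral>\<^sup>+x. ennreal (cascade_weight w v x ^ m) \<partial>M) =
    ennreal (\<Prod>k<length v. expectation (\<lambda>x. w [v ! k] x ^ m))"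
proof -
  \<comment> \<open>The proper prefixes of \<open>v\<close>, that is, the indices of the tuples met
    along \<open>v\<close>.\<close>
  define I where "I = (\<lambda>k. take k v) ` {..<length v}"
  have inj: "inj_on (\<lambda>k. take k v) {..<length v}"
    by (auto simp: inj_on_def dest: arg_cong[where f = length])
  have tk: "take k v \<in> lists S" for k
    using v by (auto dest: in_set_takeD)
  have vk: "v ! k \<in> S" if "k < length v" for k
    using v that by (auto simp: subset_iff)
  have I: "I \<subseteq> lists S" unfolding I_def using tk by auto
  \<comment> \<open>From the tuple at a prefix \<open>u\<close>, \<open>Y u\<close> selects the
    coordinate of the letter that follows \<open>u\<close> in \<open>v\<close>.\<close>
  define Y where "Y = (\<lambda>(u :: 'a list) (y :: 'a \<Rightarrow> real). ennreal (y (v ! length u) ^ m))"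
  have Y: "Y u \<in> borel_measurable (\<Pi>\<^sub>M j\<in>S. borel)" if "u \<in> I" for u
  proof -
    have "v ! length u \<in> S" using that vk by (auto simp: I_def)
    then show ?thesis unfolding Y_def by measurable
  qed
  have "indep_vars (\<lambda>_. borel) (\<lambda>u x. Y u (\<lambda>j\<in>S. w (u @ [j]) x)) I"
    by (rule indep_vars_compose2[OF indep_vars_subset[OF w_indep I] Y])
  from indep_vars_nn_integral[OF _ this]
  have "(\<integral>\<^sup>+x. (\<Prod>u\<in>I. Y u (\<lambda>j\<in>S. w (u @ [j]) x)) \<partial>M) =
      (\<Prod>u\<in>I. \<integral>\<^sup>+x. Y u (\<lambda>j\<in>S. w (u @ [j]) x) \<partial>M)"
    by (simp add: I_def)
  also have "(\<lambda>x. \<Prod>u\<in>I. Y u (\<lambda>j\<in>S. w (u @ [j]) x)) =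
      (\<lambda>x. \<Prod>k<length v. ennreal (w (take k v @ [v ! k]) x ^ m))"
    unfolding I_def prod.reindex[OF inj]
    by (intro ext prod.cong refl) (simp add: Y_def vk)
  also have "(\<Prod>u\<in>I. \<integral>\<^sup>+x. Y u (\<lambda>j\<in>S. w (u @ [j]) x) \<partial>M) =
      (\<Prod>k<length v. ennreal (expectation (\<lambda>x. w [v ! k] x ^ m)))"
    unfolding I_def prod.reindex[OF inj]
    by (intro prod.cong refl) (simp add: Y_def vk tk nn_integral_w_power)
  also have "\<dots> = ennreal (\<Prod>k<length v. expectation (\<lambda>x. w [v ! k] x ^ m))"
    using vk by (intro prod_ennreal integral_nonneg_AE) (auto simp: w_single)
  also have "(\<integral>\<^sup>+x. (\<Prod>k<length v. ennreal (w (take k v @ [v ! k]) x ^ m)) \<partial>M) =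
      (\<integral>\<^sup>+x. ennreal (cascade_weight w v x ^ m) \<partial>M)"
  proof (rule nn_integral_cong)
    fix x assume x: "x \<in> space M"
    have "0 \<le> w (take k v @ [v ! k]) x" if "k < length v" for k
      using w_range[of "take k v @ [v ! k]" x] tk vk x that by auto
    then show "(\<Prod>k<length v. ennreal (w (take k v @ [v ! k]) x ^ m)) =
        ennreal (cascade_weight w v x ^ m)"
      by (subst prod_ennreal) (auto simp: cascade_weight_eq_prod prod_power_distrib)
  qed
  finally show ?thesis .
qed

text \<open>Since \<open>w [j]\<close> has values in \<open>[0,1]\<close>, its powers converge
  pointwise to the indicator of \<open>w [j] = 1\<close>; dominated convergence with bound 1 gives
  the limit of each moment.\<close>

lemma eventually_moments_less_1:
  assumes "(\<Sum>j\<in>S. prob {x \<in> space M. w [j] x = 1}) < 1"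
  shows "\<forall>\<^sub>F m in sequentially. (\<Sum>j\<in>S. expectation (\<lambda>x. w [j] x ^ m)) < 1"
proof -
  have "(\<lambda>m. expectation (\<lambda>x. w [j] x ^ m)) \<longlonglongrightarrow> prob {x \<in> space M. w [j] x = 1}"
    if j: "j \<in> S" for j
  proof -
    note [measurable] = w_single(1)[OF j]
    have "(\<lambda>m. expectation (\<lambda>x. w [j] x ^ m)) \<longlonglongrightarrow>
        expectation (indicator {x \<in> space M. w [j] x = 1})"
    proof (rule integral_dominated_convergence[where w = "\<lambda>_. 1"])
      show "AE x in M. (\<lambda>m. w [j] x ^ m) \<longlonglongrightarrow> indicator {x \<in> space M. w [j] x = 1} x"
      proof (rule AE_I2)
        fix x assume x: "x \<in> space M"
        then show "(\<lambda>m. w [j] x ^ m) \<longlonglongrightarrow> indicator {x \<in> space M. w [j] x = 1} x"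
          using w_single(2,3)[OF j x]
          by (cases "w [j] x = 1") (auto intro!: LIMSEQ_power_zero)
      qed
    qed (use w_single[OF j] in \<open>auto simp: power_le_one\<close>)
    then show ?thesis by simp
  qed
  then have "(\<lambda>m. \<Sum>j\<in>S. expectation (\<lambda>x. w [j] x ^ m)) \<longlonglongrightarrow>
      (\<Sum>j\<in>S. prob {x \<in> space M. w [j] x = 1})"
    by (rule tendsto_sum)
  from order_tendstoD(2)[OF this assms] show ?thesis .
qed

text \<open>All factors are indexed by nonempty prefixes of \<open>i\<close>, so the weight is
  measurable for the sigma-algebra of the past at time \<open>length i\<close>, from which
  \<open>X i\<close> is independent.\<close>

lemma cascade_weight_vimage_past_events:
  assumes i: "i \<in> lists S" and A: "A \<in> sets borel"
  shows "cascade_weight w i -` A \<inter> space M \<in> past_events M S w (length i)"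
proof -
  \<comment> \<open>The generator of \<open>past_events\<close>; as a measure space
    \<open>sigma (space M) G\<close>, the past admits the usual closure of measurability under
    products.\<close>
  define G where "G = (\<Union>i\<in>{j\<in>lists S. j \<noteq> [] \<and> length j \<le> length i}.
    {w i -` A \<inter> space M | A. A \<in> sets borel})"
  have G: "G \<subseteq> Pow (space M)" unfolding G_def by auto
  have "w (take k i) \<in> borel_measurable (sigma (space M) G)" if k: "k \<in> {1..length i}" for k
  proof (rule measurableI)
    fix B :: "real set" assume B: "B \<in> sets borel"
    have "take k i \<in> {j\<in>lists S. j \<noteq> [] \<and> length j \<le> length i}"
      using i k by (auto dest: in_set_takeD)
    then have "w (take k i) -` B \<inter> space M \<in> G" unfolding G_def using B by blast
    then show "w (take k i) -` B \<inter> space (sigma (space M) G) \<in> sets (sigma (space M) G)"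
      using G by (simp add: space_measure_of)
  qed simp
  then have "cascade_weight w i \<in> borel_measurable (sigma (space M) G)"
    unfolding cascade_weight_def by (rule borel_measurable_prod)
  from measurable_sets[OF this A] show ?thesis
    using G by (simp add: past_events_def G_def space_measure_of sets_measure_of)
qed

end

section \<open>Perturbed weights and domination of the height\<close>

context perturbed_multiplicative_cascade
begin

text \<open>Independence from the past restricts to preimages under the weight. Both families of
  preimages are stable under intersection, so it extends to the sigma-algebras they
  generate.\<close>

lemma indep_var_X_cascade_weight:
  assumes i: "i \<in> lists S"
  shows "indep_var borel (X i) borel (cascade_weight w i)"
proof -
  have "indep_set {X i -` A \<inter> space M | A. A \<in> sets borel}
      {cascade_weight w i -` A \<inter> space M | A. A \<in> sets borel}"
    using X_indep[OF i] unfolding indep_set_def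
    by (rule indep_sets_mono_sets)
       (auto split: bool.split intro: cascade_weight_vimage_past_events[OF i])
  then show ?thesis
    unfolding indep_var_eq using X_measurable[OF i] cascade_weight_measurable[OF i]
    by (intro conjI indep_set_sigma_sets Int_stable_preimages)
qed

text \<open>Identical distribution lets one constant \<open>C\<close> serve all words.\<close>

lemma X_power_moment:
  assumes "0 < m"
  obtains C where "0 \<le> C" "\<And>i. i \<in> lists S \<Longrightarrow> (\<integral>\<^sup>+x. ennreal (X i x ^ m) \<partial>M) = ennreal C"
proof
  let ?C = "expectation (\<lambda>x. X [] x ^ m)"
  show "0 \<le> ?C" using X_nonneg by (intro integral_nonneg_AE) auto
  fix i assume i: "i \<in> lists S"
  have "(\<integral>\<^sup>+x. ennreal (X i x ^ m) \<partial>M) = (\<integral>\<^sup>+y. ennreal (y ^ m) \<partial>distr M borel (X i))"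
    using X_measurable[OF i] by (simp add: nn_integral_distr)
  also have "\<dots> = (\<integral>\<^sup>+y. ennreal (y ^ m) \<partial>distr M borel (X []))"
    using X_identically_distributed[OF i, of "[]"] by simp
  also have "\<dots> = (\<integral>\<^sup>+x. ennreal (X [] x ^ m) \<partial>M)"
    using X_measurable[of "[]"] by (simp add: nn_integral_distr)
  also have "\<dots> = ennreal ?C"
  proof (rule nn_integral_eq_integral)
    \<comment> \<open>At the value 0 both powers vanish, because \<open>0 < m\<close>.\<close>
    have "X [] x powr real m = X [] x ^ m" if "x \<in> space M" for x
      using X_nonneg[of "[]" x] that assms by (cases "X [] x = 0") (auto simp: powr_realpow)
    then have "integrable M (\<lambda>x. X [] x powr real m) \<longleftrightarrow> integrable M (\<lambda>x. X [] x ^ m)"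
      by (intro Bochner_Integration.integrable_cong) auto
    then show "integrable M (\<lambda>x. X [] x ^ m)"
      using X_moments[of "[]" "real m"] assms by simp
    show "AE x in M. 0 \<le> X [] x ^ m" using X_nonneg by auto
  qed
  finally show "(\<integral>\<^sup>+x. ennreal (X i x ^ m) \<partial>M) = ennreal ?C" .
qed

lemma nn_integral_perturbed_weight_power:
  assumes i: "i \<in> lists S"
  shows "(\<integral>\<^sup>+x. ennreal ((cascade_weight w i x * X i x) ^ m) \<partial>M) =
    ennreal (\<Prod>k<length i. expectation (\<lambda>x. w [i ! k] x ^ m)) * (\<integral>\<^sup>+x. ennreal (X i x ^ m) \<partial>M)"
proof -
  have "(\<integral>\<^sup>+x. ennreal ((cascade_weight w i x * X i x) ^ m) \<partial>M) =
      (\<integral>\<^sup>+x. ennreal (X i x ^ m) * ennreal (cascade_weight w i x ^ m) \<partial>M)"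
    using cascade_weight_nonneg[OF i] X_nonneg[OF i]
    by (intro nn_integral_cong) (simp add: power_mult_distrib ennreal_mult mult.commute)
  also have "\<dots> = (\<integral>\<^sup>+x. ennreal (X i x ^ m) \<partial>M) * (\<integral>\<^sup>+x. ennreal (cascade_weight w i x ^ m) \<partial>M)"
    using indep_var_compose[OF indep_var_X_cascade_weight[OF i],
        of "\<lambda>y. ennreal (y ^ m)" borel "\<lambda>y. ennreal (y ^ m)" borel]
    by (intro indep_var_nn_integral) (simp add: comp_def)
  finally show ?thesis using i by (simp add: nn_integral_cascade_weight_power mult.commute)
qed

text \<open>The dominating random variable of the argument, grouped by word length. The
  deterministic factor \<open>r ^ (- m * n)\<close> is kept separate so that it can leave the
  integral; values in \<open>ennreal\<close> make the sum meaningful before its finiteness is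
  known.\<close>

definition weighted_word_sum :: "real \<Rightarrow> nat \<Rightarrow> 'm \<Rightarrow> ennreal" where
  "weighted_word_sum r m x = (\<Sum>n. \<Sum>v\<in>{v. set v \<subseteq> S \<and> length v = n}.
     ennreal ((cascade_weight w v x * X v x) ^ m) * ennreal ((1 / r ^ m) ^ n))"

lemma weighted_word_sum_measurable: "weighted_word_sum r m \<in> borel_measurable M"
proof -
  have "(\<lambda>x. ennreal ((cascade_weight w v x * X v x) ^ m) * ennreal ((1 / r ^ m) ^ n)) \<in> borel_measurable M"
    if "set v \<subseteq> S" for v n
    using that X_measurable[of v] cascade_weight_measurable[of v] by (auto simp: lists_eq_set)
  then show ?thesis unfolding weighted_word_sum_def[abs_def]
    by (intro borel_measurable_suminf_order borel_measurable_sum) auto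
qed

text \<open>Level \<open>n\<close> contributes \<open>C * (q / r ^ m) ^ n\<close> with
  \<open>C\<close> the common moment of the perturbations, and the hypothesis makes the ratio less
  than 1.\<close>

lemma nn_integral_weighted_word_sum:
  assumes m: "0 < m" and q: "(\<Sum>j\<in>S. expectation (\<lambda>x. w [j] x ^ m)) < r ^ m" and r: "0 < r"
  shows "(\<integral>\<^sup>+x. weighted_word_sum r m x \<partial>M) < \<infinity>"
proof -
  define q where "q = (\<Sum>j\<in>S. expectation (\<lambda>x. w [j] x ^ m))"
  obtain C where C: "0 \<le> C" "\<And>i. i \<in> lists S \<Longrightarrow> (\<integral>\<^sup>+x. ennreal (X i x ^ m) \<partial>M) = ennreal C"
    using X_power_moment[OF m] by blast
  have p: "0 \<le> expectation (\<lambda>x. w [j] x ^ m)" if "j \<in> S" for j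
    using w_single[OF that] by (intro integral_nonneg_AE) auto
  have q0: "0 \<le> q" unfolding q_def using p by (rule sum_nonneg)
  let ?W = "\<lambda>n. {v. set v \<subseteq> S \<and> length v = n}"
  have [measurable]: "(\<lambda>x. ennreal ((cascade_weight w v x * X v x) ^ m)) \<in> borel_measurable M"
    if "set v \<subseteq> S" for v
    using that X_measurable[of v] cascade_weight_measurable[of v] by (auto simp: lists_eq_set)
  have level: "(\<integral>\<^sup>+x. (\<Sum>v\<in>?W n. ennreal ((cascade_weight w v x * X v x) ^ m) *
      ennreal ((1 / r ^ m) ^ n)) \<partial>M) = ennreal (C * (q / r ^ m) ^ n)" for n
  proof -
    have "(\<integral>\<^sup>+x. (\<Sum>v\<in>?W n. ennreal ((cascade_weight w v x * X v x) ^ m) *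
        ennreal ((1 / r ^ m) ^ n)) \<partial>M) =
      (\<Sum>v\<in>?W n. ennreal (\<Prod>k<n. expectation (\<lambda>x. w [v ! k] x ^ m)) * ennreal C *
        ennreal ((1 / r ^ m) ^ n))"
      by (subst nn_integral_sum)
         (auto simp: nn_integral_multc nn_integral_perturbed_weight_power C in_lists_conv_set subset_iff
           intro!: sum.cong)
    also have "\<dots> = (\<Sum>v\<in>?W n. ennreal (\<Prod>k<n. expectation (\<lambda>x. w [v ! k] x ^ m))) *
        ennreal C * ennreal ((1 / r ^ m) ^ n)"
      by (simp add: sum_distrib_right)
    also have "(\<Sum>v\<in>?W n. ennreal (\<Prod>k<n. expectation (\<lambda>x. w [v ! k] x ^ m))) = ennreal (q ^ n)"
    proof (subst sum_ennreal)
      fix v assume "v \<in> ?W n"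
      then show "0 \<le> (\<Prod>k<n. expectation (\<lambda>x. w [v ! k] x ^ m))"
        by (intro prod_nonneg p) (auto simp: subset_iff)
    qed (simp add: sum_prod_words[of "\<lambda>j. expectation (\<lambda>x. w [j] x ^ m)"] q_def)
    also have "ennreal (q ^ n) * ennreal C * ennreal ((1 / r ^ m) ^ n) =
        ennreal (C * (q / r ^ m) ^ n)"
      using q0 C(1) r by (simp add: ennreal_mult[symmetric] power_divide)
    finally show ?thesis .
  qed
  have "(\<integral>\<^sup>+x. weighted_word_sum r m x \<partial>M) = (\<Sum>n. ennreal (C * (q / r ^ m) ^ n))"
    unfolding weighted_word_sum_def
    by (subst nn_integral_suminf) (auto simp: level intro!: borel_measurable_sum)
  also have "\<dots> = ennreal (C * (1 / (1 - q / r ^ m)))"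
    using q0 q r C(1)
    by (intro suminf_ennreal_eq sums_mult geometric_sums) (auto simp: q_def[symmetric])
  finally show ?thesis by simp
qed

text \<open>Where the dominating sum has a finite value \<open>b\<close>, \<open>root m b\<close> is
  a constant valid in the geometric bound along all infinite words at once, so the uncountable
  supremum causes no loss.\<close>

lemma cascade_height_power_le:
  assumes m: "0 < m" and r: "0 < r" "r < 1" and x: "x \<in> space M"
  shows "cascade_height S w X x ^ m \<le> ennreal ((1 / (1 - r)) ^ m) * weighted_word_sum r m x"
proof (cases "weighted_word_sum r m x")
  case (real b)
  define a where "a = (\<lambda>i n. cascade_weight w (trunc i n) x * X (trunc i n) x)"
  have "a i n \<le> root m b * r ^ n" if i: "i \<in> UNIV \<rightarrow> S" for i n
  proof -
    let ?W = "{v. set v \<subseteq> S \<and> length v = n}"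
    let ?f = "\<lambda>v. ennreal ((cascade_weight w v x * X v x) ^ m) * ennreal ((1 / r ^ m) ^ n)"
    have l: "trunc i n \<in> lists S" using trunc_in_lists[OF i] .
    have a0: "0 \<le> a i n"
      unfolding a_def using cascade_weight_nonneg[OF l x] X_nonneg[OF l x] by simp
    \<comment> \<open>A single nonnegative term is bounded first by its level and then by the whole
      sum; taking \<open>m\<close>-th roots gives the bound on \<open>a i n\<close>.\<close>
    have "?f (trunc i n) \<le> (\<Sum>v\<in>?W. ?f v)"
      using l by (intro member_le_sum) (auto simp: trunc_def finite_lists_length_eq finite_S)
    also have "\<dots> \<le> weighted_word_sum r m x"
      unfolding weighted_word_sum_def
      using sum_le_suminf[of "\<lambda>n. \<Sum>v\<in>{v. set v \<subseteq> S \<and> length v = n}.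
        ennreal ((cascade_weight w v x * X v x) ^ m) * ennreal ((1 / r ^ m) ^ n)" "{n}"] by simp
    finally have "ennreal ((a i n / r ^ n) ^ m) \<le> ennreal b"
      using real a0 r
      by (simp add: a_def ennreal_mult[symmetric] power_divide power_mult[symmetric] mult.commute)
    then have "(a i n / r ^ n) ^ m \<le> b" using real by simp
    then have "root m ((a i n / r ^ n) ^ m) \<le> root m b" using m by simp
    moreover have "root m ((a i n / r ^ n) ^ m) = a i n / r ^ n"
      using m a0 r by (intro real_root_power_cancel) auto
    ultimately have "a i n / r ^ n \<le> root m b" by metis
    then show ?thesis using r by (simp add: pos_divide_le_eq)
  qed
  then have "cascade_height S w X x \<le> ennreal (root m b / (1 - r))"
    unfolding cascade_height_def using r
    by (intro SUP_least suminf_le_geometric) (auto simp: a_def)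
  then have "cascade_height S w X x ^ m \<le> ennreal (root m b / (1 - r)) ^ m"
    by (rule power_mono) simp
  also have "\<dots> = ennreal ((1 / (1 - r)) ^ m) * ennreal b"
    using r m real
    by (simp add: ennreal_power ennreal_mult[symmetric] power_divide real_root_pow_pos2)
  finally show ?thesis using real by simp
next
  case top
  \<comment> \<open>In \<open>ennreal\<close>, 0 times infinity is 0, so the constant must be
    nonzero for the right-hand side to be infinite.\<close>
  have "ennreal ((1 / (1 - r)) ^ m) \<noteq> 0" using r by simp
  then show ?thesis using top by (simp add: ennreal_mult_top)
qed

end

theorem corollary1:
  fixes M :: "'m measure" and S :: "'a set"
    and w X :: "'a list \<Rightarrow> 'm \<Rightarrow> real" and d :: real
  assumes "perturbed_multiplicative_cascade M S w X"
    and "(\<Sum>j\<in>S. measure M {x \<in> space M. w [j] x = 1}) < 1"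
    and "d \<ge> 0"
  shows "(\<integral>\<^sup>+ x. ennreal_powr (cascade_height S w X x) d \<partial>M) < \<infinity>"
proof -
  interpret perturbed_multiplicative_cascade M S w X by fact
  let ?q = "\<lambda>m. \<Sum>j\<in>S. expectation (\<lambda>x. w [j] x ^ m)"
  \<comment> \<open>The added 1 ensures \<open>0 < m\<close> even when \<open>d = 0\<close>.\<close>
  have "\<forall>\<^sub>F m in sequentially. ?q m < 1 \<and> nat \<lceil>d\<rceil> + 1 \<le> m"
    using eventually_moments_less_1[OF assms(2)] eventually_ge_at_top
    by (rule eventually_conj)
  then obtain m where q: "?q m < 1" and "nat \<lceil>d\<rceil> + 1 \<le> m"
    by (auto simp: eventually_sequentially)
  then have d: "d \<le> real m" and m: "0 < m" by linarith+
  have q0: "0 \<le> ?q m" by (intro sum_nonneg integral_nonneg_AE) (auto simp: w_single)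
  \<comment> \<open>Then \<open>r ^ m\<close> is the midpoint of \<open>?q m\<close> and 1, hence
    strictly between them.\<close>
  define r where "r = root m ((?q m + 1) / 2)"
  have r: "0 < r" "r < 1" "?q m < r ^ m"
    using q q0 m by (auto simp: r_def real_root_pow_pos2)
  let ?c = "ennreal ((1 / (1 - r)) ^ m)"
  have "(\<integral>\<^sup>+x. ennreal_powr (cascade_height S w X x) d \<partial>M) \<le>
      (\<integral>\<^sup>+x. 1 + ?c * weighted_word_sum r m x \<partial>M)"
  proof (rule nn_integral_mono)
    fix x assume "x \<in> space M"
    then show "ennreal_powr (cascade_height S w X x) d \<le> 1 + ?c * weighted_word_sum r m x"
      using ennreal_powr_le_power[OF assms(3) d m] cascade_height_power_le[OF m r(1,2)]
      by (meson add_left_mono order_trans)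
  qed
  also have "\<dots> = 1 + ?c * (\<integral>\<^sup>+x. weighted_word_sum r m x \<partial>M)"
    using weighted_word_sum_measurable
    by (simp add: nn_integral_add nn_integral_cmult emeasure_space_1)
  also have "\<dots> < \<infinity>"
    using nn_integral_weighted_word_sum[OF m r(3,1)] by (simp add: ennreal_mult_less_top)
  finally show ?thesis .
qed

end
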